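(* Let $n\in\mathbb{N}$, let $d$ be a finite field size, and let $\rho_1,\ldots,\rho_n\in(0,1)$ be reception probabilities (state-dependent receptions, heterogeneous receivers). For each $c\in\mathbb{N}$ let $\mathbf{Q}^{(c)}$ be the $n\times c$ matrix of success probabilities with entries $q_{j,k}^{(c)}=(1-d^{\,k-1-c})\rho_j$, let $X_{j,k}^{(c)}\sim\mathrm{Geo}(q_{j,k}^{(c)})$, $1\le j\le n$, $1\le k\le c$, be independent over $j$ and $k$, and set $\hat Y_{n:n}^{(c)}=\max_{1\le j\le n}\frac1c\sum_{k=1}^cX_{j,k}^{(c)}$. Suppose there exist $n$-vectors $(q_1,\ldots,q_n)$ and $(\sigma_1^2,\ldots,\sigma_n^2)$ such that for all $j$ $$\lim_{c\to\infty}\frac1c\sum_{k=1}^c\mathbb{E}[X_{j,k}^{(c)}]=\frac1{q_j}<\infty,\qquad\lim_{c\to\infty}\frac1c\sum_{k=1}^c\mathrm{Var}(X_{j,k}^{(c)})=\sigma_j^2<\infty.$$ Then, as $c\to\infty$, $\hat Y_{n:n}^{(c)}$ converges in probability to $(\min_{1\le j\le n}q_j)^{-1}$. Further, fix $r\in\mathbb{N}$ and suppose that each $X_{j,k}^{(c)}$ has uniformly bounded moments up to order $2r$. Then the displayed conditions along with this assumption ensure that, as $c\to\infty$, $\hat Y_{n:n}^{(c)}$ converges to $(\min_{1\le j\le n}q_j)^{-1}$ in $r$-th mean (in $L^r$).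
   Context: $\mathbb{N}=\{1,2,\ldots\}$. $\mathrm{Geo}(q)$ is the geometric distribution on $\{1,2,\ldots\}$ with $\mathbb{P}(X=k)=(1-q)^{k-1}q$. Here $c$ is the blocklength of random linear combinations over a field of size $d$ broadcast to $n$ receivers over independent erasure channels, and $X_{j,k}^{(c)}$ is the number of time slots receiver $j$ waits between its $(k-1)$-th and $k$-th linearly independent receptions. *)

theory Defs
  imports "HOL-Probability.Probability" "HOL-Algebra.Ring"
begin

text \<open>
  The library's \<^const>\<open>geometric_pmf\<close> counts failures and is supported on $\{0,1,\ldots\}$;
  here the distribution of the number of trials, supported on $\{1,2,\ldots\}$, is needed.
\<close>

definition Geo :: "real \<Rightarrow> nat pmf" where
  "Geo p = map_pmf Suc (geometric_pmf p)"

lemma pmf_Geo: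
  assumes "0 < p" "p \<le> 1"
  shows "pmf (Geo p) k = (if k = 0 then 0 else (1 - p) ^ (k - 1) * p)"
proof (cases k)
  case 0
  then show ?thesis by (auto simp: Geo_def pmf_eq_0_set_pmf)
next
  case (Suc m)
  have "pmf (map_pmf Suc (geometric_pmf p)) (Suc m) = pmf (geometric_pmf p) m"
    by (rule pmf_map_inj') simp
  with Suc assms show ?thesis by (simp add: Geo_def)
qed

definition has_Geo_distribution :: "'a measure \<Rightarrow> ('a \<Rightarrow> nat) \<Rightarrow> real \<Rightarrow> bool" where
  "has_Geo_distribution M X p \<longleftrightarrow>
     X \<in> M \<rightarrow>\<^sub>M count_space UNIV \<and>
     distr M (count_space UNIV) X = measure_pmf (Geo p)"

text \<open>
  The exponent $k-1-c$ is negative for $k \le c$, so it is formed over the integers.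
\<close>

definition success_prob :: "nat \<Rightarrow> (nat \<Rightarrow> real) \<Rightarrow> nat \<Rightarrow> nat \<Rightarrow> nat \<Rightarrow> real" where
  "success_prob d \<rho> c j k = (1 - real d powi (int k - 1 - int c)) * \<rho> j"

definition Y_hat_max :: "nat \<Rightarrow> nat \<Rightarrow> (nat \<Rightarrow> nat \<Rightarrow> 'a \<Rightarrow> nat) \<Rightarrow> 'a \<Rightarrow> real" where
  "Y_hat_max n c X \<omega> =
     Max ((\<lambda>j. (1 / real c) * (\<Sum>k = 1..c. real (X j k \<omega>))) ` {1..n})"

text \<open>
  In the two modes of convergence below, sequences are indexed by $c \ge 1$ (the value at $0$ is
  irrelevant). The limit is a constant, so every member of the sequence may live on its own
  probability space.
\<close>

definition converges_in_probability ::
  "(nat \<Rightarrow> 'a measure) \<Rightarrow> (nat \<Rightarrow> 'a \<Rightarrow> real) \<Rightarrow> real \<Rightarrow> bool" where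
  "converges_in_probability M Y l \<longleftrightarrow>
     (\<forall>c\<ge>1. Y c \<in> borel_measurable (M c)) \<and>
     (\<forall>\<epsilon>>0. (\<lambda>c. measure (M c) {\<omega> \<in> space (M c). \<bar>Y c \<omega> - l\<bar> > \<epsilon>}) \<longlonglongrightarrow> 0)"

definition converges_in_mean ::
  "nat \<Rightarrow> (nat \<Rightarrow> 'a measure) \<Rightarrow> (nat \<Rightarrow> 'a \<Rightarrow> real) \<Rightarrow> real \<Rightarrow> bool" where
  "converges_in_mean r M Y l \<longleftrightarrow>
     (\<forall>c\<ge>1. Y c \<in> borel_measurable (M c) \<and> integrable (M c) (\<lambda>\<omega>. \<bar>Y c \<omega>\<bar> ^ r)) \<and>
     (\<lambda>c. prob_space.expectation (M c) (\<lambda>\<omega>. \<bar>Y c \<omega> - l\<bar> ^ r)) \<longlonglongrightarrow> 0"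

text \<open>The bound is uniform over $c$, $j$ and $k$.\<close>

definition uniformly_bounded_moments ::
  "nat \<Rightarrow> nat \<Rightarrow> (nat \<Rightarrow> 'a measure) \<Rightarrow> (nat \<Rightarrow> nat \<Rightarrow> nat \<Rightarrow> 'a \<Rightarrow> nat) \<Rightarrow> bool" where
  "uniformly_bounded_moments m n M X \<longleftrightarrow>
     (\<exists>B. \<forall>c\<ge>1. \<forall>j\<in>{1..n}. \<forall>k\<in>{1..c}. \<forall>p\<in>{1..m}.
        integrable (M c) (\<lambda>\<omega>. real (X c j k \<omega>) ^ p) \<and>
        prob_space.expectation (M c) (\<lambda>\<omega>. real (X c j k \<omega>) ^ p) \<le> B)"

end

theory Submission
  imports Defs
begin

text \<open>
  Each receiver's average has variance $\frac1c \cdot \frac1c\sum_k \mathrm{Var}(X_{j,k}^{(c)}) \to 0$,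
  so Chebyshev's inequality gives a weak law per receiver, and a maximum of finitely many averages
  is close to the maximum of their limits as soon as all of them are close. The $2r$-th moments of
  the maximum are bounded by Jensen's inequality; bounded $2r$-th moments make the $r$-th powers
  uniformly integrable, which upgrades convergence in probability to convergence in $r$-th mean.
\<close>

section \<open>Weak law of large numbers for triangular arrays\<close>

text \<open>Induction on the index set: a new variable is independent of the sum of the others, so
  the two are uncorrelated. Square integrability of the sum is carried along because the induction
  step needs it to expand the variance.\<close>

lemma (in prob_space) indep_vars_variance_sum:
  fixes Y :: "'i \<Rightarrow> 'a \<Rightarrow> real"
  assumes "finite I" "indep_vars (\<lambda>_. borel) Y I"
    and "\<And>i. i \<in> I \<Longrightarrow> integrable M (\<lambda>\<omega>. (Y i \<omega>)\<^sup>2)"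
  shows "integrable M (\<lambda>\<omega>. (\<Sum>i\<in>I. Y i \<omega>)\<^sup>2) \<and>
    variance (\<lambda>\<omega>. \<Sum>i\<in>I. Y i \<omega>) = (\<Sum>i\<in>I. variance (Y i))"
  using assms
proof (induction I rule: finite_induct)
  case empty
  then show ?case by simp
next
  case (insert i I)
  define S where "S \<omega> = (\<Sum>i\<in>I. Y i \<omega>)" for \<omega>
  have meas: "Y l \<in> borel_measurable M" if "l \<in> insert i I" for l
    using insert.prems(1) that by (auto simp: indep_vars_def2)
  have "indep_vars (\<lambda>_. borel) Y I"
    using insert.prems(1) by (rule indep_vars_subset) auto
  with insert have S2: "integrable M (\<lambda>\<omega>. (S \<omega>)\<^sup>2)"
    and varS: "variance S = (\<Sum>i\<in>I. variance (Y i))"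
    by (auto simp: S_def[abs_def])
  have [measurable]: "S \<in> borel_measurable M" "Y i \<in> borel_measurable M"
    unfolding S_def using meas by (auto intro!: borel_measurable_sum)
  have Y2: "integrable M (\<lambda>\<omega>. (Y i \<omega>)\<^sup>2)"
    using insert.prems(2) by simp
  have intS: "integrable M S" and intY: "integrable M (Y i)"
    using S2 Y2 by (auto intro: square_integrable_imp_integrable)
  have ind: "indep_var borel (Y i) borel S"
    unfolding S_def using insert.hyps insert.prems(1) by (rule indep_vars_sum)
  \<comment> \<open>The cross term of the expanded square. By independence its expectation is the
    product of the means, which cancels against the cross term of the squared mean.\<close>
  define P where "P \<omega> = Y i \<omega> * S \<omega>" for \<omega>
  have intP: "integrable M P" and expP: "expectation P = expectation (Y i) * expectation S"
    unfolding P_def using indep_var_integrable[OF ind intY intS]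
      indep_var_lebesgue_integral[OF ind intY intS] by auto
  have sq: "(\<lambda>\<omega>. (Y i \<omega> + S \<omega>)\<^sup>2) = (\<lambda>\<omega>. (Y i \<omega>)\<^sup>2 + (S \<omega>)\<^sup>2 + 2 * P \<omega>)"
    by (auto simp: P_def power2_sum)
  have int: "integrable M (\<lambda>\<omega>. (Y i \<omega> + S \<omega>)\<^sup>2)"
    unfolding sq using Y2 S2 intP by simp
  have "variance (\<lambda>\<omega>. Y i \<omega> + S \<omega>)
      = expectation (\<lambda>\<omega>. (Y i \<omega> + S \<omega>)\<^sup>2) - (expectation (\<lambda>\<omega>. Y i \<omega> + S \<omega>))\<^sup>2"
    using int intS intY by (intro variance_eq) auto
  also have "\<dots> = variance (Y i) + variance S"
    unfolding sq using Y2 S2 intP intS intY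
    by (simp add: variance_eq expP power2_sum)
  finally show ?case
    using insert.hyps int varS by (simp add: S_def)
qed

text \<open>Chebyshev controls the distance of the row average \<open>A c\<close> to its own mean
  \<open>m c\<close>, not to \<mu>. Since \<open>m c\<close> tends to \<mu>, the tolerance
  \<epsilon> is split: eventually \<open>m c\<close> is within \<epsilon>/2 of \<mu>, and a
  deviation above \<epsilon> from \<mu> forces one of at least \<epsilon>/2 from
  \<open>m c\<close>.\<close>

lemma weak_law_triangular_array:
  fixes M :: "nat \<Rightarrow> 'a measure" and I :: "nat \<Rightarrow> 'i set" and Y :: "nat \<Rightarrow> 'i \<Rightarrow> 'a \<Rightarrow> real"
  assumes prob: "\<And>c. c \<ge> 1 \<Longrightarrow> prob_space (M c)"
    and fin: "\<And>c. c \<ge> 1 \<Longrightarrow> finite (I c)"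
    and indep: "\<And>c. c \<ge> 1 \<Longrightarrow> prob_space.indep_vars (M c) (\<lambda>_. borel) (Y c) (I c)"
    and sq: "\<And>c i. c \<ge> 1 \<Longrightarrow> i \<in> I c \<Longrightarrow> integrable (M c) (\<lambda>\<omega>. (Y c i \<omega>)\<^sup>2)"
    and mean: "(\<lambda>c. (1 / real c) * (\<Sum>i\<in>I c. prob_space.expectation (M c) (Y c i))) \<longlonglongrightarrow> \<mu>"
    and var: "(\<lambda>c. (1 / real c) * (\<Sum>i\<in>I c. prob_space.variance (M c) (Y c i))) \<longlonglongrightarrow> v"
  shows "converges_in_probability M (\<lambda>c \<omega>. (1 / real c) * (\<Sum>i\<in>I c. Y c i \<omega>)) \<mu>"
proof -
  define A where "A c \<omega> = (1 / real c) * (\<Sum>i\<in>I c. Y c i \<omega>)" for c \<omega>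
  define m where "m c = (1 / real c) * (\<Sum>i\<in>I c. prob_space.expectation (M c) (Y c i))" for c
  define w where "w c = (1 / real c) * (\<Sum>i\<in>I c. prob_space.variance (M c) (Y c i))" for c
  have measY: "Y c i \<in> borel_measurable (M c)" if "c \<ge> 1" "i \<in> I c" for c i
  proof -
    interpret prob_space "M c" by (rule prob) fact
    show ?thesis using indep[OF that(1)] that(2) by (auto simp: indep_vars_def2)
  qed
  have measA: "A c \<in> borel_measurable (M c)" if "c \<ge> 1" for c
    unfolding A_def using measY that
    by (intro borel_measurable_times borel_measurable_const borel_measurable_sum) simp
  have cheb: "measure (M c) {\<omega> \<in> space (M c). \<bar>A c \<omega> - m c\<bar> \<ge> a} \<le> (1 / real c) * w c / a\<^sup>2"
    if c: "c \<ge> 1" and a: "a > 0" for c a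
  proof -
    interpret prob_space "M c" by (rule prob) fact
    let ?S = "\<lambda>\<omega>. \<Sum>i\<in>I c. Y c i \<omega>"
    have S: "integrable (M c) (\<lambda>\<omega>. (?S \<omega>)\<^sup>2)"
      "variance ?S = (\<Sum>i\<in>I c. variance (Y c i))"
      using indep_vars_variance_sum[OF fin indep sq] c by auto
    have "expectation ?S = (\<Sum>i\<in>I c. expectation (Y c i))"
      using square_integrable_imp_integrable[OF measY[OF c] sq[OF c]]
      by (intro Bochner_Integration.integral_sum) blast
    then have EA: "expectation (A c) = m c"
      by (simp add: A_def[abs_def] m_def)
    have "variance (A c) = expectation (\<lambda>\<omega>. (1 / real c)\<^sup>2 * (?S \<omega> - expectation ?S)\<^sup>2)"
      by (simp only: A_def[abs_def] integral_mult_right_zero power_mult_distrib[symmetric]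
          right_diff_distrib)
    also have "\<dots> = (1 / real c)\<^sup>2 * variance ?S"
      by (rule integral_mult_right_zero)
    \<comment> \<open>One of the two factors 1/c is absorbed into the normalised variance
      \<open>w c\<close>; the other survives and drives the bound to 0.\<close>
    also have "\<dots> = (1 / real c) * w c"
      unfolding S(2) w_def by (simp add: power2_eq_square[of "1 / real c"] del: power_one_over)
    finally have VA: "variance (A c) = (1 / real c) * w c" .
    have "integrable (M c) (\<lambda>\<omega>. (A c \<omega>)\<^sup>2)"
      unfolding A_def power_mult_distrib using S(1) by simp
    from Chebyshev_inequality[OF measA[OF c] this a] show ?thesis
      by (simp only: EA VA[unfolded EA])
  qed
  have "(\<lambda>c. measure (M c) {\<omega> \<in> space (M c). \<bar>A c \<omega> - \<mu>\<bar> > \<epsilon>}) \<longlonglongrightarrow> 0" if \<epsilon>: "\<epsilon> > 0" for \<epsilon>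
  proof (rule tendsto_sandwich[OF _ _ tendsto_const])
    have "(\<lambda>c. (1 / real c) * w c / (\<epsilon> / 2)\<^sup>2) \<longlonglongrightarrow> 0 * v / (\<epsilon> / 2)\<^sup>2"
      using var \<epsilon> unfolding w_def by (intro tendsto_intros lim_1_over_n) auto
    then show "(\<lambda>c. (1 / real c) * w c / (\<epsilon> / 2)\<^sup>2) \<longlonglongrightarrow> 0"
      by simp
    have "\<forall>\<^sub>F c in sequentially. dist (m c) \<mu> < \<epsilon> / 2"
      using mean \<epsilon> unfolding m_def by (intro tendstoD) auto
    then show "\<forall>\<^sub>F c in sequentially. measure (M c) {\<omega> \<in> space (M c). \<bar>A c \<omega> - \<mu>\<bar> > \<epsilon>}
        \<le> (1 / real c) * w c / (\<epsilon> / 2)\<^sup>2"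
      using eventually_ge_at_top[of 1]
    proof eventually_elim
      case (elim c)
      interpret prob_space "M c" by (rule prob) fact
      note [measurable] = measA[OF elim(2)]
      have "{\<omega> \<in> space (M c). \<bar>A c \<omega> - \<mu>\<bar> > \<epsilon>}
          \<subseteq> {\<omega> \<in> space (M c). \<bar>A c \<omega> - m c\<bar> \<ge> \<epsilon> / 2}"
        using elim(1) unfolding dist_real_def by safe linarith
      then have "measure (M c) {\<omega> \<in> space (M c). \<bar>A c \<omega> - \<mu>\<bar> > \<epsilon>}
          \<le> measure (M c) {\<omega> \<in> space (M c). \<bar>A c \<omega> - m c\<bar> \<ge> \<epsilon> / 2}"
        by (intro finite_measure_mono) auto
      with cheb[of c "\<epsilon> / 2"] elim(2) \<epsilon> show ?case by simp
    qed
  qed auto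
  with measA show ?thesis
    unfolding converges_in_probability_def A_def by blast
qed

section \<open>Maxima of finitely many convergent sequences\<close>

text \<open>The contrapositive of the maximum being 1-Lipschitz in the sup norm: if the functions
  are \<epsilon>-close everywhere, comparing them at a maximiser of each bounds the gap of the
  maxima in both directions.\<close>

lemma Max_image_diff_gt_imp:
  fixes f g :: "'i \<Rightarrow> 'b :: linordered_idom"
  assumes "finite I" "I \<noteq> {}" "\<bar>Max (f ` I) - Max (g ` I)\<bar> > \<epsilon>"
  shows "\<exists>i\<in>I. \<bar>f i - g i\<bar> > \<epsilon>"
proof (rule ccontr)
  assume "\<not> ?thesis"
  then have close: "f i \<le> g i + \<epsilon>" "g i \<le> f i + \<epsilon>" if "i \<in> I" for i
    using that by (force simp: abs_le_iff not_less)+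
  obtain i where i: "i \<in> I" "Max (f ` I) = f i"
    by (rule imageE[OF Max_in[of "f ` I"]]) (use assms in auto)
  obtain k where k: "k \<in> I" "Max (g ` I) = g k"
    by (rule imageE[OF Max_in[of "g ` I"]]) (use assms in auto)
  have "g i \<le> Max (g ` I)" "f k \<le> Max (f ` I)"
    using assms(1) i(1) k(1) by (intro Max_ge; simp)+
  with close(1)[OF i(1)] close(2)[OF k(1)] i k assms(3) show False
    by (auto simp: abs_if split: if_splits)
qed

lemma converges_in_probability_Max:
  fixes M :: "nat \<Rightarrow> 'a measure" and Y :: "'i \<Rightarrow> nat \<Rightarrow> 'a \<Rightarrow> real"
  assumes prob: "\<And>c. c \<ge> 1 \<Longrightarrow> prob_space (M c)"
    and I: "finite I" "I \<noteq> {}"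
    and conv: "\<And>i. i \<in> I \<Longrightarrow> converges_in_probability M (Y i) (l i)"
  shows "converges_in_probability M (\<lambda>c \<omega>. Max ((\<lambda>i. Y i c \<omega>) ` I)) (Max (l ` I))"
proof -
  have measY: "Y i c \<in> borel_measurable (M c)" if "i \<in> I" "c \<ge> 1" for i c
    using conv that by (auto simp: converges_in_probability_def)
  have "(\<lambda>c. measure (M c) {\<omega> \<in> space (M c). \<bar>Max ((\<lambda>i. Y i c \<omega>) ` I) - Max (l ` I)\<bar> > \<epsilon>})
      \<longlonglongrightarrow> 0" if \<epsilon>: "\<epsilon> > 0" for \<epsilon>
  proof (rule tendsto_sandwich[OF _ _ tendsto_const])
    have "(\<lambda>c. \<Sum>i\<in>I. measure (M c) {\<omega> \<in> space (M c). \<bar>Y i c \<omega> - l i\<bar> > \<epsilon>}) \<longlonglongrightarrow> (\<Sum>i\<in>I. 0)"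
      using conv \<epsilon> by (intro tendsto_sum) (auto simp: converges_in_probability_def)
    then show "(\<lambda>c. \<Sum>i\<in>I. measure (M c) {\<omega> \<in> space (M c). \<bar>Y i c \<omega> - l i\<bar> > \<epsilon>}) \<longlonglongrightarrow> 0"
      by simp
    show "\<forall>\<^sub>F c in sequentially.
        measure (M c) {\<omega> \<in> space (M c). \<bar>Max ((\<lambda>i. Y i c \<omega>) ` I) - Max (l ` I)\<bar> > \<epsilon>}
        \<le> (\<Sum>i\<in>I. measure (M c) {\<omega> \<in> space (M c). \<bar>Y i c \<omega> - l i\<bar> > \<epsilon>})"
      using eventually_ge_at_top[of 1]
    proof eventually_elim
      case (elim c)
      interpret prob_space "M c" by (rule prob) fact
      have sets: "{\<omega> \<in> space (M c). \<bar>Y i c \<omega> - l i\<bar> > \<epsilon>} \<in> sets (M c)" if "i \<in> I" for i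
        using measY[OF that elim] by measurable
      \<comment> \<open>Union bound: a large deviation of the maximum is a large deviation of some
        member, and a finite sum of null sequences is null.\<close>
      have "measure (M c) {\<omega> \<in> space (M c). \<bar>Max ((\<lambda>i. Y i c \<omega>) ` I) - Max (l ` I)\<bar> > \<epsilon>}
          \<le> measure (M c) (\<Union>i\<in>I. {\<omega> \<in> space (M c). \<bar>Y i c \<omega> - l i\<bar> > \<epsilon>})"
        using sets I by (intro finite_measure_mono) (auto dest: Max_image_diff_gt_imp[OF I])
      also have "\<dots> \<le> (\<Sum>i\<in>I. measure (M c) {\<omega> \<in> space (M c). \<bar>Y i c \<omega> - l i\<bar> > \<epsilon>})"
        using sets I by (intro finite_measure_subadditive_finite) auto
      finally show ?case .
    qed
  qed auto
  moreover have "(\<lambda>\<omega>. Max ((\<lambda>i. Y i c \<omega>) ` I)) \<in> borel_measurable (M c)" if "c \<ge> 1" for c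
    using measY that I by (intro borel_measurable_Max) auto
  ultimately show ?thesis
    unfolding converges_in_probability_def by blast
qed

section \<open>From convergence in probability to convergence in mean\<close>

text \<open>Bound the difference by twice the larger absolute value, whose power is one of the two
  summands. This transfers moment bounds from \<open>Y c\<close> to \<open>Y c - l\<close>.\<close>

lemma power_abs_diff_le:
  fixes a b :: real
  shows "\<bar>a - b\<bar> ^ m \<le> 2 ^ m * (\<bar>a\<bar> ^ m + \<bar>b\<bar> ^ m)"
proof -
  have "\<bar>a - b\<bar> ^ m \<le> (2 * max \<bar>a\<bar> \<bar>b\<bar>) ^ m"
    by (intro power_mono) auto
  also have "\<dots> \<le> 2 ^ m * (\<bar>a\<bar> ^ m + \<bar>b\<bar> ^ m)"
    unfolding power_mult_distrib by (intro mult_left_mono) (auto simp: max_def)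
  finally show ?thesis .
qed

lemma power_le_one_plus_power_double:
  fixes x :: real
  shows "x ^ r \<le> 1 + x ^ (2 * r)"
proof -
  have "0 \<le> (x ^ r - 1 / 2)\<^sup>2"
    by simp
  then show ?thesis
    by (simp add: power2_diff power_mult power_even_eq field_simps)
qed

text \<open>Split according to whether the deviation exceeds \<epsilon>. Below \<epsilon> its
  \<open>r\<close>-th power is at most \<open>\<epsilon> ^ r\<close>. Above, AM-GM with a weight
  \<eta> trades it for \<eta> times the \<open>2r\<close>-th power, small in mean by the moment
  bound, plus a constant multiple of the indicator of a rare event.\<close>

lemma converges_in_mean_if_bounded_moment:
  fixes M :: "nat \<Rightarrow> 'a measure"
  assumes prob: "\<And>c. c \<ge> 1 \<Longrightarrow> prob_space (M c)"
    and r: "r \<ge> 1"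
    and conv: "converges_in_probability M Y l"
    and int: "\<And>c. c \<ge> 1 \<Longrightarrow> integrable (M c) (\<lambda>\<omega>. \<bar>Y c \<omega>\<bar> ^ (2 * r))"
    and bound: "\<And>c. c \<ge> 1 \<Longrightarrow> prob_space.expectation (M c) (\<lambda>\<omega>. \<bar>Y c \<omega>\<bar> ^ (2 * r)) \<le> B"
  shows "converges_in_mean r M Y l"
proof -
  have meas: "Y c \<in> borel_measurable (M c)" if "c \<ge> 1" for c
    using conv that by (simp add: converges_in_probability_def)
  \<comment> \<open>Stated for a general \<open>f\<close> because it serves both
    \<open>Y c - l\<close>, when expectations are compared, and \<open>Y c\<close> itself, as the
    conclusion demands.\<close>
  have half: "integrable (M c) (\<lambda>\<omega>. \<bar>f \<omega>\<bar> ^ r)"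
    if "c \<ge> 1" "f \<in> borel_measurable (M c)" "integrable (M c) (\<lambda>\<omega>. \<bar>f \<omega>\<bar> ^ (2 * r))"
    for c and f :: "'a \<Rightarrow> real"
  proof -
    interpret prob_space "M c" by (rule prob) fact
    show ?thesis
    proof (rule Bochner_Integration.integrable_bound)
      show "integrable (M c) (\<lambda>\<omega>. 1 + \<bar>f \<omega>\<bar> ^ (2 * r))"
        using that by simp
      show "AE \<omega> in M c. norm (\<bar>f \<omega>\<bar> ^ r) \<le> norm (1 + \<bar>f \<omega>\<bar> ^ (2 * r))"
      proof (rule AE_I2)
        fix \<omega>
        show "norm (\<bar>f \<omega>\<bar> ^ r) \<le> norm (1 + \<bar>f \<omega>\<bar> ^ (2 * r))"
          using power_le_one_plus_power_double[of "\<bar>f \<omega>\<bar>" r]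
          by (simp del: power_even_abs)
      qed
    qed (use that in measurable)
  qed
  define C where "C = 2 ^ (2 * r) * (B + \<bar>l\<bar> ^ (2 * r))"
  have dev: "integrable (M c) (\<lambda>\<omega>. \<bar>Y c \<omega> - l\<bar> ^ (2 * r))"
    "prob_space.expectation (M c) (\<lambda>\<omega>. \<bar>Y c \<omega> - l\<bar> ^ (2 * r)) \<le> C" if c: "c \<ge> 1" for c
  proof -
    interpret prob_space "M c" by (rule prob) fact
    have [measurable]: "Y c \<in> borel_measurable (M c)" by (rule meas) fact
    have dom: "integrable (M c) (\<lambda>\<omega>. 2 ^ (2 * r) * (\<bar>Y c \<omega>\<bar> ^ (2 * r) + \<bar>l\<bar> ^ (2 * r)))"
      using int[OF c] by (intro integrable_mult_right Bochner_Integration.integrable_add) auto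
    show dev: "integrable (M c) (\<lambda>\<omega>. \<bar>Y c \<omega> - l\<bar> ^ (2 * r))"
    proof (rule Bochner_Integration.integrable_bound[OF dom])
      show "AE \<omega> in M c. norm (\<bar>Y c \<omega> - l\<bar> ^ (2 * r))
          \<le> norm (2 ^ (2 * r) * (\<bar>Y c \<omega>\<bar> ^ (2 * r) + \<bar>l\<bar> ^ (2 * r)))"
      proof (rule AE_I2)
        fix \<omega>
        have "\<bar>Y c \<omega> - l\<bar> ^ (2 * r) \<le> 2 ^ (2 * r) * (\<bar>Y c \<omega>\<bar> ^ (2 * r) + \<bar>l\<bar> ^ (2 * r))"
          by (rule power_abs_diff_le)
        moreover have "0 \<le> \<bar>Y c \<omega> - l\<bar> ^ (2 * r)"
          by simp
        ultimately show "norm (\<bar>Y c \<omega> - l\<bar> ^ (2 * r))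
            \<le> norm (2 ^ (2 * r) * (\<bar>Y c \<omega>\<bar> ^ (2 * r) + \<bar>l\<bar> ^ (2 * r)))"
          unfolding real_norm_def by linarith
      qed
    qed measurable
    have "expectation (\<lambda>\<omega>. \<bar>Y c \<omega> - l\<bar> ^ (2 * r))
        \<le> expectation (\<lambda>\<omega>. 2 ^ (2 * r) * (\<bar>Y c \<omega>\<bar> ^ (2 * r) + \<bar>l\<bar> ^ (2 * r)))"
      by (intro integral_mono dev dom power_abs_diff_le)
    also have "\<dots> = 2 ^ (2 * r) * (expectation (\<lambda>\<omega>. \<bar>Y c \<omega>\<bar> ^ (2 * r)) + \<bar>l\<bar> ^ (2 * r))"
      using int[OF c] by (simp add: prob_space del: power_even_abs)
    also have "\<dots> \<le> C"
      unfolding C_def using bound[OF c] by (intro mult_left_mono add_right_mono) auto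
    finally show "expectation (\<lambda>\<omega>. \<bar>Y c \<omega> - l\<bar> ^ (2 * r)) \<le> C" .
  qed
  have "0 \<le> prob_space.expectation (M 1) (\<lambda>\<omega>. \<bar>Y 1 \<omega> - l\<bar> ^ (2 * r))"
    by (intro integral_nonneg_AE) auto
  then have C: "C \<ge> 0"
    using dev(2)[of 1] by linarith
  have "(\<lambda>c. prob_space.expectation (M c) (\<lambda>\<omega>. \<bar>Y c \<omega> - l\<bar> ^ r)) \<longlonglongrightarrow> 0"
  proof (rule tendstoI)
    fix e :: real
    assume e: "e > 0"
    \<comment> \<open>The cap at 1 gives \<open>\<epsilon> ^ r \<le> \<epsilon>\<close>. In \<eta>,
      the summand 1 keeps the denominator positive when \<open>C\<close> is 0.\<close>
    define \<epsilon> where "\<epsilon> = min 1 (e / 4)"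
    define \<eta> where "\<eta> = e / (4 * (C + 1))"
    have \<epsilon>: "\<epsilon> > 0" "\<epsilon> ^ r \<le> e / 4"
    proof -
      show "\<epsilon> > 0" using e by (simp add: \<epsilon>_def)
      then have "\<epsilon> ^ r \<le> \<epsilon> ^ 1"
        using r by (intro power_decreasing) (auto simp: \<epsilon>_def)
      then show "\<epsilon> ^ r \<le> e / 4" by (simp add: \<epsilon>_def)
    qed
    have \<eta>: "\<eta> > 0" "\<eta> * C \<le> e / 4"
      using e C by (auto simp: \<eta>_def field_simps)
    let ?A = "\<lambda>c. {\<omega> \<in> space (M c). \<bar>Y c \<omega> - l\<bar> > \<epsilon>}"
    have "(\<lambda>c. measure (M c) (?A c)) \<longlonglongrightarrow> 0"
      using conv \<epsilon>(1) by (simp add: converges_in_probability_def)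
    \<comment> \<open>The threshold is chosen so that, after division by \<open>4 * \<eta>\<close>,
      the indicator term contributes at most \<open>e / 4\<close>. The three terms then total at
      most \<open>3 * e / 4\<close>, strictly below \<open>e\<close>.\<close>
    then have "\<forall>\<^sub>F c in sequentially. dist (measure (M c) (?A c)) 0 < e * \<eta>"
      by (rule tendstoD) (use e \<eta> in simp)
    then show "\<forall>\<^sub>F c in sequentially.
        dist (prob_space.expectation (M c) (\<lambda>\<omega>. \<bar>Y c \<omega> - l\<bar> ^ r)) 0 < e"
      using eventually_ge_at_top[of 1]
    proof eventually_elim
      case (elim c)
      interpret prob_space "M c" by (rule prob) fact
      have [measurable]: "Y c \<in> borel_measurable (M c)" by (rule meas) fact
      have le: "\<bar>Y c \<omega> - l\<bar> ^ r
          \<le> \<epsilon> ^ r + \<eta> * \<bar>Y c \<omega> - l\<bar> ^ (2 * r) + indicator (?A c) \<omega> / (4 * \<eta>)"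
        if "\<omega> \<in> space (M c)" for \<omega>
      proof (cases "\<omega> \<in> ?A c")
        case True
        define z where "z = \<bar>Y c \<omega> - l\<bar> ^ r"
        \<comment> \<open>AM-GM: $z \le \eta z^2 + 1/(4\eta)$\<close>
        have "0 \<le> \<eta> * (z - 1 / (2 * \<eta>))\<^sup>2"
          using \<eta> by simp
        also have "\<dots> = \<eta> * z\<^sup>2 - z + 1 / (4 * \<eta>)"
          using \<eta> by (simp add: power2_eq_square field_simps)
        finally have "z \<le> \<eta> * z\<^sup>2 + 1 / (4 * \<eta>)"
          by simp
        moreover have "0 \<le> \<epsilon> ^ r"
          using \<epsilon>(1) by simp
        moreover have "\<bar>Y c \<omega> - l\<bar> ^ (2 * r) = z\<^sup>2"
          unfolding z_def by (metis mult.commute power_mult)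
        ultimately show ?thesis
          unfolding indicator_simps(1)[OF True] z_def[symmetric] by simp
      next
        case False
        then have "\<bar>Y c \<omega> - l\<bar> ^ r \<le> \<epsilon> ^ r"
          using that by (intro power_mono) auto
        moreover have "0 \<le> \<eta> * \<bar>Y c \<omega> - l\<bar> ^ (2 * r)"
          using \<eta> by simp
        moreover have "indicator (?A c) \<omega> = (0::real)"
          using False by (rule indicator_simps(2))
        ultimately show ?thesis
          by simp
      qed
      have ind: "integrable (M c) (indicat_real (?A c))"
        by (intro integrable_real_indicator) (auto simp: emeasure_eq_measure)
      have "expectation (\<lambda>\<omega>. \<bar>Y c \<omega> - l\<bar> ^ r)
          \<le> expectation (\<lambda>\<omega>. \<epsilon> ^ r + \<eta> * \<bar>Y c \<omega> - l\<bar> ^ (2 * r) + indicator (?A c) \<omega> / (4 * \<eta>))"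
        using dev(1)[OF elim(2)] ind half[OF elim(2) _ dev(1)[OF elim(2)]]
        by (intro integral_mono le Bochner_Integration.integrable_add integrable_mult_right
            integrable_divide) auto
      also have "\<dots> = \<epsilon> ^ r + \<eta> * expectation (\<lambda>\<omega>. \<bar>Y c \<omega> - l\<bar> ^ (2 * r)) + prob (?A c) / (4 * \<eta>)"
        using dev(1)[OF elim(2)] ind by (simp add: prob_space del: power_even_abs)
      also have "\<dots> \<le> e / 4 + \<eta> * C + prob (?A c) / (4 * \<eta>)"
        using \<epsilon>(2) \<eta>(1) dev(2)[OF elim(2)]
        by (intro add_mono mult_left_mono) auto
      also have "\<dots> < e / 4 + e / 4 + e / 2"
      proof -
        have "prob (?A c) / (4 * \<eta>) \<le> e / 4"
          using elim(1) \<eta>(1) by (simp add: field_simps)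
        with \<eta>(2) e show ?thesis by linarith
      qed
      finally show ?case
        by (simp add: dist_real_def integral_nonneg_AE)
    qed
  qed
  with meas half int show ?thesis
    unfolding converges_in_mean_def by blast
qed

section \<open>Powers of averages and of maxima\<close>

text \<open>Jensen's inequality with equal weights. Nonnegativity of the \<open>x i\<close> matters
  because odd powers are in general convex only on the half-line.\<close>

lemma mean_power_le:
  fixes x :: "'i \<Rightarrow> real"
  assumes "finite S" "S \<noteq> {}" "\<And>i. i \<in> S \<Longrightarrow> x i \<ge> 0"
  shows "((1 / real (card S)) * (\<Sum>i\<in>S. x i)) ^ m \<le> (1 / real (card S)) * (\<Sum>i\<in>S. x i ^ m)"
proof -
  have convex: "convex_on {0::real..} (\<lambda>x. x ^ m)"
    by (cases "even m") (auto intro: convex_power_odd convex_on_subset[OF convex_power_even])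
  have "(\<Sum>i\<in>S. (1 / real (card S)) *\<^sub>R x i) ^ m \<le> (\<Sum>i\<in>S. (1 / real (card S)) * x i ^ m)"
    using assms by (intro convex_on_sum[OF _ _ convex]) auto
  then show ?thesis
    by (simp add: sum_distrib_left)
qed

lemma Max_power_le_sum:
  fixes f :: "'i \<Rightarrow> real"
  assumes "finite I" "I \<noteq> {}"
  shows "\<bar>Max (f ` I)\<bar> ^ m \<le> (\<Sum>i\<in>I. \<bar>f i\<bar> ^ m)"
proof -
  obtain i where "i \<in> I" "Max (f ` I) = f i"
    by (rule imageE[OF Max_in[of "f ` I"]]) (use assms in auto)
  with assms(1) show ?thesis
    by (auto intro: member_le_sum[where f = "\<lambda>i. \<bar>f i\<bar> ^ m"])
qed

section \<open>Square integrability of geometric variables\<close>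

text \<open>With \<open>x = 1 - p\<close>, the series of \<open>x ^ k * k\<^sup>2\<close> has as its
  terms the squares of \<open>f k = sqrt x ^ k * k\<close>. The series of \<open>f\<close> converges
  by the known series for \<open>k\<close> times a geometric term, so \<open>f\<close> is eventually
  below 1 and there dominates its own square.\<close>

lemma integrable_Geo_square:
  assumes "0 < p" "p < 1"
  shows "integrable (measure_pmf (Geo p)) (\<lambda>k. (real k)\<^sup>2)"
proof -
  define x where "x = 1 - p"
  have x: "0 < x" "x < 1"
    using assms by (auto simp: x_def)
  define f where "f k = sqrt x ^ k * real k" for k
  have f0: "f k \<ge> 0" for k
    using x by (simp add: f_def)
  have "summable (\<lambda>k. norm (f k))"
    unfolding f_def using geometric_sums_times_norm[of "sqrt x"] x by (auto simp: sums_iff)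
  then have sf: "summable f"
    by (rule summable_norm_cancel)
  then have "\<forall>\<^sub>F k in sequentially. f k < 1"
    by (intro order_tendstoD(2)[OF summable_LIMSEQ_zero]) auto
  then have "\<forall>\<^sub>F k in sequentially. norm ((f k)\<^sup>2) \<le> f k"
  proof eventually_elim
    case (elim k)
    then show ?case
      using f0[of k] mult_left_le[of "f k" "f k"] by (simp add: power2_eq_square)
  qed
  then have "summable (\<lambda>k. (f k)\<^sup>2)"
    using sf by (rule summable_comparison_test_ev)
  moreover have "(f k)\<^sup>2 = x ^ k * (real k)\<^sup>2" for k
  proof -
    have "(sqrt x ^ k)\<^sup>2 = x ^ k"
      using x by (simp add: power_mult[symmetric] mult.commute[of k] power_mult[of _ 2])
    then show ?thesis
      by (simp only: f_def power_mult_distrib)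
  qed
  \<comment> \<open>The shift matches \<open>Geo\<close> as the image of the failure count under
    \<open>Suc\<close>. The surplus factor \<open>x\<close> is then divided out and \<open>p\<close>
    put in, which yields the geometric weights.\<close>
  ultimately have "summable (\<lambda>k. x ^ Suc k * (real (Suc k))\<^sup>2)"
    by (simp only: summable_Suc_iff[of "\<lambda>k. x ^ k * (real k)\<^sup>2"])
  then have "summable (\<lambda>k. x * (x ^ k * (real (Suc k))\<^sup>2))"
    by (simp add: mult_ac)
  then have "summable (\<lambda>k. x ^ k * (real (Suc k))\<^sup>2)"
    by (rule summable_mult_D) (use x in auto)
  then have "summable (\<lambda>k. p * (x ^ k * (real (Suc k))\<^sup>2))"
    by (rule summable_mult)
  then have "integrable (measure_pmf (geometric_pmf p)) (\<lambda>k. (real (Suc k))\<^sup>2)"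
    unfolding measure_pmf_eq_density using assms
    by (subst integrable_density)
      (auto simp: integrable_count_space_nat_iff x_def mult_ac abs_mult)
  then show ?thesis
    by (simp add: Geo_def)
qed

lemma integrable_square_if_has_Geo_distribution:
  assumes "has_Geo_distribution M X p" "0 < p" "p < 1"
  shows "integrable M (\<lambda>\<omega>. (real (X \<omega>))\<^sup>2)"
proof -
  have "integrable (distr M (count_space UNIV) X) (\<lambda>k. (real k)\<^sup>2)"
    using assms integrable_Geo_square by (simp add: has_Geo_distribution_def)
  then show ?thesis
    using assms(1) by (subst (asm) integrable_distr_eq) (auto simp: has_Geo_distribution_def)
qed

section \<open>Success probabilities and their reciprocals\<close>

lemma card_carrier_field_ge_2:
  assumes "Ring.field F" "finite (carrier F)"
  shows "card (carrier F) \<ge> 2"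
proof -
  interpret Ring.field F by fact
  have "card {\<zero>\<^bsub>F\<^esub>, \<one>\<^bsub>F\<^esub>} \<le> card (carrier F)"
    using assms(2) by (intro card_mono) auto
  then show ?thesis
    using zero_not_one by simp
qed

text \<open>For \<open>k \<le> c\<close> the exponent is at most -1, so \<open>d \<ge> 2\<close>
  puts the power of \<open>d\<close> strictly between 0 and 1. Both bounds feed the square
  integrability of geometric variables.\<close>

lemma success_prob_bounds:
  assumes "d \<ge> 2" "0 < \<rho> j" "\<rho> j < 1" "k \<in> {1..c}"
  shows "0 < success_prob d \<rho> c j k" "success_prob d \<rho> c j k < 1"
proof -
  \<comment> \<open>The negated exponent as a natural number; the subtraction does not truncate, and
    \<open>k = c\<close> gives the smallest value 1.\<close>
  define m where "m = Suc c - k"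
  have "int k - 1 - int c = - int m" and m: "m \<ge> 1"
    using assms(4) by (auto simp: m_def)
  then have sp: "success_prob d \<rho> c j k = (1 - inverse (real d ^ m)) * \<rho> j"
    by (simp add: success_prob_def power_int_minus)
  have "real d ^ m > 1"
    using assms(1) m by (intro one_less_power) auto
  then have u: "0 < inverse (real d ^ m)" "inverse (real d ^ m) < 1"
    by (auto simp only: inverse_less_1_iff inverse_positive_iff_positive intro: order.strict_trans[OF zero_less_one])
  show "0 < success_prob d \<rho> c j k"
    using u assms(2) unfolding sp by (intro mult_pos_pos) auto
  have "(1 - inverse (real d ^ m)) * \<rho> j < 1 * 1"
    using u assms by (intro mult_strict_mono) auto
  then show "success_prob d \<rho> c j k < 1"
    unfolding sp by simp
qed

text \<open>Reciprocals reverse the order of positive reals, so a minimiser of \<open>q\<close>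
  maximises \<open>1 / q\<close>: the slowest receiver determines the limit.\<close>

lemma Max_inverse_image:
  fixes q :: "'i \<Rightarrow> real"
  assumes "finite I" "I \<noteq> {}" "\<And>i. i \<in> I \<Longrightarrow> 0 < q i"
  shows "Max ((\<lambda>i. 1 / q i) ` I) = inverse (Min (q ` I))"
proof (rule Max_eqI)
  obtain k where k: "k \<in> I" "Min (q ` I) = q k"
    by (rule imageE[OF Min_in[of "q ` I"]]) (use assms in auto)
  then show "inverse (Min (q ` I)) \<in> (\<lambda>i. 1 / q i) ` I"
    by (auto simp: divide_inverse)
  fix y assume "y \<in> (\<lambda>i. 1 / q i) ` I"
  then obtain i where i: "i \<in> I" "y = 1 / q i"
    by auto
  have "q k \<le> q i"
    using assms i k by (metis Min_le finite_imageI imageI)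
  then show "y \<le> inverse (Min (q ` I))"
    using assms(3)[OF k(1)] i k by (simp add: divide_inverse le_imp_inverse_le)
qed (use assms in auto)

section \<open>Convergence of the maximal normalised waiting time\<close>

theorem proposition13:
  fixes n d :: nat
    and F :: "('f, 'm) ring_scheme"
    and \<rho> q \<sigma> :: "nat \<Rightarrow> real"
    and M :: "nat \<Rightarrow> 'a measure"
    and X :: "nat \<Rightarrow> nat \<Rightarrow> nat \<Rightarrow> 'a \<Rightarrow> nat"
  assumes "n \<ge> 1"
    and "Ring.field F" and "finite (carrier F)" and "d = card (carrier F)"
    and "\<And>j. j \<in> {1..n} \<Longrightarrow> 0 < \<rho> j \<and> \<rho> j < 1"
    and "\<And>c. c \<ge> 1 \<Longrightarrow> prob_space (M c)"
    and "\<And>c j k. c \<ge> 1 \<Longrightarrow> j \<in> {1..n} \<Longrightarrow> k \<in> {1..c} \<Longrightarrow>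
           has_Geo_distribution (M c) (X c j k) (success_prob d \<rho> c j k)"
    and "\<And>c. c \<ge> 1 \<Longrightarrow>
           prob_space.indep_vars (M c) (\<lambda>_. count_space UNIV) (\<lambda>(j, k). X c j k)
             ({1..n} \<times> {1..c})"
    and "\<And>j. j \<in> {1..n} \<Longrightarrow> 0 < q j"
    and "\<And>j. j \<in> {1..n} \<Longrightarrow>
           (\<lambda>c. (1 / real c) *
             (\<Sum>k = 1..c. prob_space.expectation (M c) (\<lambda>\<omega>. real (X c j k \<omega>))))
             \<longlonglongrightarrow> 1 / q j"
    and "\<And>j. j \<in> {1..n} \<Longrightarrow>
           (\<lambda>c. (1 / real c) *
             (\<Sum>k = 1..c. prob_space.variance (M c) (\<lambda>\<omega>. real (X c j k \<omega>))))
             \<longlonglongrightarrow> (\<sigma> j)\<^sup>2"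
  shows "converges_in_probability M (\<lambda>c. Y_hat_max n c (X c)) (inverse (Min (q ` {1..n}))) \<and>
    (\<forall>r\<ge>1. uniformly_bounded_moments (2 * r) n M X \<longrightarrow>
       converges_in_mean r M (\<lambda>c. Y_hat_max n c (X c)) (inverse (Min (q ` {1..n}))))"
proof -
  note field = assms(2) and finF = assms(3) and d = assms(4) and \<rho> = assms(5) and prob = assms(6)
    and geo = assms(7) and indep = assms(8) and q = assms(9) and mean = assms(10) and var = assms(11)
  let ?l = "inverse (Min (q ` {1..n}))"
  have I: "finite {1..n}" "{1..n} \<noteq> {}"
    using assms(1) by auto
  have d2: "d \<ge> 2"
    using card_carrier_field_ge_2[OF field finF] d by simp
  \<comment> \<open>This comes from the geometric law, not from the variance limits: a Bochner
    integral defaults to 0 on non-integrable functions, so a limit of such integrals certifies no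
    integrability.\<close>
  have X2: "integrable (M c) (\<lambda>\<omega>. (real (X c j k \<omega>))\<^sup>2)"
    if "c \<ge> 1" "j \<in> {1..n}" "k \<in> {1..c}" for c j k
    using geo[OF that] success_prob_bounds[OF d2 _ _ that(3)] \<rho>[OF that(2)]
    by (intro integrable_square_if_has_Geo_distribution) auto
  \<comment> \<open>Independence is given for the family indexed by pairs. Row \<open>c\<close> of
    receiver \<open>j\<close> is therefore indexed by \<open>{j} \<times> {1..c}\<close>, so that
    passing to a subset of indices suffices; this identity returns to sums over
    \<open>k\<close>.\<close>
  have pair_sum: "(\<Sum>p\<in>{j} \<times> {1..c}. f p) = (\<Sum>k = 1..c. f (j, k))"
    for j c and f :: "nat \<times> nat \<Rightarrow> real"
    using sum.cartesian_product'[of f "{j}" "{1..c}"] by simp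
  define A where "A j c \<omega> = (1 / real c) * (\<Sum>k = 1..c. real (X c j k \<omega>))" for j c \<omega>
  have "converges_in_probability M (A j) (1 / q j)" if j: "j \<in> {1..n}" for j
  proof -
    have "converges_in_probability M
        (\<lambda>c \<omega>. (1 / real c) * (\<Sum>p\<in>{j} \<times> {1..c}. real (X c (fst p) (snd p) \<omega>))) (1 / q j)"
    proof (rule weak_law_triangular_array[where I = "\<lambda>c. {j} \<times> {1..c}"])
      fix c :: nat
      assume c: "c \<ge> 1"
      interpret prob_space "M c" by (rule prob) fact
      have "indep_vars (\<lambda>_. count_space UNIV) (\<lambda>(j, k). X c j k) ({j} \<times> {1..c})"
        using indep[OF c] by (rule indep_vars_subset) (use j in auto)
      then have "indep_vars (\<lambda>_. borel) (\<lambda>p \<omega>. real ((\<lambda>(j, k). X c j k) p \<omega>)) ({j} \<times> {1..c})"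
        by (rule indep_vars_compose2) auto
      then show "indep_vars (\<lambda>_. borel) (\<lambda>p \<omega>. real (X c (fst p) (snd p) \<omega>)) ({j} \<times> {1..c})"
        by (simp add: case_prod_beta)
    next
      show "(\<lambda>c. (1 / real c) * (\<Sum>p\<in>{j} \<times> {1..c}.
          prob_space.expectation (M c) (\<lambda>\<omega>. real (X c (fst p) (snd p) \<omega>)))) \<longlonglongrightarrow> 1 / q j"
        unfolding pair_sum fst_conv snd_conv by (rule mean[OF j])
      show "(\<lambda>c. (1 / real c) * (\<Sum>p\<in>{j} \<times> {1..c}.
          prob_space.variance (M c) (\<lambda>\<omega>. real (X c (fst p) (snd p) \<omega>)))) \<longlonglongrightarrow> (\<sigma> j)\<^sup>2"
        unfolding pair_sum fst_conv snd_conv by (rule var[OF j])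
    qed (use prob X2 j in auto)
    then show ?thesis
      unfolding pair_sum fst_conv snd_conv A_def[abs_def] .
  qed
  then have "converges_in_probability M (\<lambda>c \<omega>. Max ((\<lambda>j. A j c \<omega>) ` {1..n}))
      (Max ((\<lambda>j. 1 / q j) ` {1..n}))"
    using prob I by (intro converges_in_probability_Max)
  moreover have Y: "(\<lambda>c. Y_hat_max n c (X c)) = (\<lambda>c \<omega>. Max ((\<lambda>j. A j c \<omega>) ` {1..n}))"
    by (simp add: Y_hat_max_def A_def fun_eq_iff)
  ultimately have conv: "converges_in_probability M (\<lambda>c. Y_hat_max n c (X c)) ?l"
    using Max_inverse_image[OF I q] by simp
  have "converges_in_mean r M (\<lambda>c. Y_hat_max n c (X c)) ?l"
    if r: "r \<ge> 1" and mom: "uniformly_bounded_moments (2 * r) n M X" for r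
  proof -
    have "2 * r \<in> {1..2 * r}"
      using r by simp
    with mom obtain B where B: "integrable (M c) (\<lambda>\<omega>. real (X c j k \<omega>) ^ (2 * r))"
      "prob_space.expectation (M c) (\<lambda>\<omega>. real (X c j k \<omega>) ^ (2 * r)) \<le> B"
      if "c \<ge> 1" "j \<in> {1..n}" "k \<in> {1..c}" for c j k
      unfolding uniformly_bounded_moments_def by blast
    \<comment> \<open>An integrable majorant of the \<open>2r\<close>-th power of the maximum: the
      maximum is bounded by a sum over receivers, and Jensen moves the power inside each average.
      Its mean is at most \<open>n * B\<close>, uniformly in \<open>c\<close>.\<close>
    define D where "D c \<omega> = (\<Sum>j\<in>{1..n}. (1 / real c) * (\<Sum>k = 1..c. real (X c j k \<omega>) ^ (2 * r)))"
      for c \<omega>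
    have YD: "\<bar>Y_hat_max n c (X c) \<omega>\<bar> ^ (2 * r) \<le> D c \<omega>" if "c \<ge> 1" for c \<omega>
    proof -
      have "\<bar>Y_hat_max n c (X c) \<omega>\<bar> ^ (2 * r) \<le> (\<Sum>j\<in>{1..n}. \<bar>A j c \<omega>\<bar> ^ (2 * r))"
        unfolding fun_cong[OF Y] by (rule Max_power_le_sum[OF I])
      also have "\<dots> \<le> D c \<omega>"
        unfolding D_def
      proof (rule sum_mono)
        fix j
        have "A j c \<omega> \<ge> 0"
          by (simp add: A_def sum_nonneg)
        show "\<bar>A j c \<omega>\<bar> ^ (2 * r) \<le> (1 / real c) * (\<Sum>k = 1..c. real (X c j k \<omega>) ^ (2 * r))"
          unfolding abs_of_nonneg[OF \<open>A j c \<omega> \<ge> 0\<close>]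
          using mean_power_le[of "{1..c}" "\<lambda>k. real (X c j k \<omega>)" "2 * r"] that
          by (simp add: A_def)
      qed
      finally show ?thesis .
    qed
    have D: "integrable (M c) (D c)" "prob_space.expectation (M c) (D c) \<le> real n * B"
      if c: "c \<ge> 1" for c
    proof -
      show "integrable (M c) (D c)"
        unfolding D_def
        by (intro Bochner_Integration.integrable_sum integrable_mult_right B(1)[OF c])
      have "prob_space.expectation (M c) (D c) = (\<Sum>j\<in>{1..n}. prob_space.expectation (M c)
          (\<lambda>\<omega>. (1 / real c) * (\<Sum>k = 1..c. real (X c j k \<omega>) ^ (2 * r))))"
        unfolding D_def by (intro Bochner_Integration.integral_sum
            Bochner_Integration.integrable_sum integrable_mult_right B(1)[OF c])
      also have "\<dots> = (\<Sum>j\<in>{1..n}. (1 / real c) *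
          (\<Sum>k = 1..c. prob_space.expectation (M c) (\<lambda>\<omega>. real (X c j k \<omega>) ^ (2 * r))))"
        unfolding integral_mult_right_zero
        by (intro sum.cong refl arg_cong2[where f = "(*)"] Bochner_Integration.integral_sum
            B(1)[OF c])
      also have "\<dots> \<le> (\<Sum>j\<in>{1..n}. (1 / real c) * (\<Sum>k = 1..c. B))"
        using B(2)[OF c] by (intro sum_mono mult_left_mono) auto
      also have "\<dots> = real n * B"
        using c by simp
      finally show "prob_space.expectation (M c) (D c) \<le> real n * B" .
    qed
    have measY: "Y_hat_max n c (X c) \<in> borel_measurable (M c)" if "c \<ge> 1" for c
      using conv that by (simp add: converges_in_probability_def)
    have int: "integrable (M c) (\<lambda>\<omega>. \<bar>Y_hat_max n c (X c) \<omega>\<bar> ^ (2 * r))" if c: "c \<ge> 1" for c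
    proof (rule Bochner_Integration.integrable_bound[OF D(1)[OF c]])
      show "AE \<omega> in M c. norm (\<bar>Y_hat_max n c (X c) \<omega>\<bar> ^ (2 * r)) \<le> norm (D c \<omega>)"
      proof (rule AE_I2)
        fix \<omega>
        show "norm (\<bar>Y_hat_max n c (X c) \<omega>\<bar> ^ (2 * r)) \<le> norm (D c \<omega>)"
          using YD[OF c, of \<omega>] by (simp add: norm_power)
      qed
    qed (use measY[OF c] in measurable)
    have "prob_space.expectation (M c) (\<lambda>\<omega>. \<bar>Y_hat_max n c (X c) \<omega>\<bar> ^ (2 * r)) \<le> real n * B"
      if c: "c \<ge> 1" for c
      using integral_mono[OF int[OF c] D(1)[OF c] YD[OF c]] D(2)[OF c] by simp
    then show ?thesis
      using prob r conv int by (intro converges_in_mean_if_bounded_moment)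
  qed
  with conv show ?thesis
    by blast
qed

end
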